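(* Let $m\ge2$ be a fixed integer and let $\omega(n)\to\infty$ as $n\to\infty$. If $\rho=\rho(n)$ satisfies $$\rho\ge R_n+\frac{\omega(n)}{(\log n)^2},\qquad R_n=\frac{m\binom n2}{2\log(n!)},$$ then $$\sum_{\pi\in\mathfrak S_n^m}\exp\left(\frac{\operatorname{wt}(\pi)}{\rho}\right)=(n!)^m\cdot(1+o(1))\qquad(n\to\infty).$$
   Context: $\mathfrak S_n$ is the symmetric group on $[n]=\{1,\dots,n\}$. For $\pi=(\pi_1,\dots,\pi_m)\in\mathfrak S_n^m$ and $1\le k<\ell\le m$ let $\tau_{k\ell}=\pi_k^{-1}\pi_\ell$, let $f_{k\ell}(\pi)$ be its number of fixed points in $[n]$ and $t_{k\ell}(\pi)$ its number of transpositions ($2$-cycles in its cycle decomposition). Set $\operatorname{wt}_{k\ell}(\pi)=\binom{f_{k\ell}(\pi)}2+t_{k\ell}(\pi)$ and $\operatorname{wt}(\pi)=\sum_{1\le k<\ell\le m}\operatorname{wt}_{k\ell}(\pi)$. $\log$ is the natural logarithm. *)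

theory Defs
  imports
    Complex_Main
    "HOL-Library.FuncSet"
    "HOL-Library.Landau_Symbols"
    "HOL-Combinatorics.Permutations"
    "HOL-Combinatorics.Orbits"
begin

definition sym_tuples :: "nat \<Rightarrow> nat \<Rightarrow> (nat \<Rightarrow> nat \<Rightarrow> nat) set" where
  "sym_tuples m n = {1..m} \<rightarrow>\<^sub>E {p. p permutes {1..n}}"

definition rel_perm :: "(nat \<Rightarrow> nat \<Rightarrow> nat) \<Rightarrow> nat \<Rightarrow> nat \<Rightarrow> nat \<Rightarrow> nat" where
  "rel_perm \<pi> k l = inv (\<pi> k) \<circ> \<pi> l"

definition num_fixed :: "nat \<Rightarrow> (nat \<Rightarrow> nat) \<Rightarrow> nat" where
  "num_fixed n p = card {x \<in> {1..n}. p x = x}"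

(* The cycles of a permutation of {1..n} are identified with their supports,
   which are its orbits; a 2-cycle is determined by its support. *)
definition num_transpositions :: "nat \<Rightarrow> (nat \<Rightarrow> nat) \<Rightarrow> nat" where
  "num_transpositions n p = card {C \<in> orbit p ` {1..n}. card C = 2}"

definition wt_pair :: "nat \<Rightarrow> (nat \<Rightarrow> nat \<Rightarrow> nat) \<Rightarrow> nat \<Rightarrow> nat \<Rightarrow> nat" where
  "wt_pair n \<pi> k l =
     (num_fixed n (rel_perm \<pi> k l) choose 2) + num_transpositions n (rel_perm \<pi> k l)"

definition wt :: "nat \<Rightarrow> nat \<Rightarrow> (nat \<Rightarrow> nat \<Rightarrow> nat) \<Rightarrow> nat" where
  "wt m n \<pi> = (\<Sum>(k, l) \<in> {(k, l). 1 \<le> k \<and> k < l \<and> l \<le> m}. wt_pair n \<pi> k l)"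

(* For n < 2 the denominator is 0 and the value is the junk value 0. *)
definition R :: "nat \<Rightarrow> nat \<Rightarrow> real" where
  "R m n = real m * real (n choose 2) / (2 * ln (fact n))"

end

theory Submission
  imports Defs "HOL-Real_Asymp.Real_Asymp"
begin

text \<open>Call \<open>w(\<sigma>)\<close> the weight of one permutation, the number of two-element sets that
\<open>\<sigma>\<close> maps to themselves. As \<open>exp\<close> is at least \<open>1\<close> on nonnegative numbers, the sum over
tuples is at least \<open>(n!)^m\<close>, and everything lies in the upper bound.

\<^bold>\<open>Reduction to one permutation.\<close> The pairs \<open>k < l\<close> form a complete graph on \<open>m\<close> vertices,
and twice the total weight is the sum over the centres \<open>k\<close> of the weights of the \<open>m - 1\<close> edges at
\<open>k\<close>. By convexity of \<open>exp\<close>, the summand of a tuple is at most the average over \<open>k\<close> of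
\<open>exp\<close> of \<open>m/(2\<rho>)\<close> times the weight of the star at \<open>k\<close>. In a star the relative
permutations are independent and uniformly distributed, so its sum is \<open>n! Z^(m-1)\<close>
(\<open>tuple_sum_le\<close>), where \<open>Z\<close> is the sum of \<open>exp(\<beta> w(\<sigma>))\<close> over single permutations,
with \<open>\<beta> = m/(2\<rho>)\<close>. Nothing is lost in the threshold: the hypothesis on \<open>\<rho>\<close> says that
\<open>1/\<beta>\<close> exceeds \<open>(n choose 2)/ln n!\<close> by at least \<open>(2/m) \<omega>(n)/(ln n)^2\<close>, and at
\<open>\<beta> = ln n!/(n choose 2)\<close> the identity alone contributes \<open>n!\<close> to \<open>Z\<close>.

\<^bold>\<open>One permutation.\<close> At most \<open>n!/(f! 2^t t!)\<close> permutations have \<open>f\<close> fixed points and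
\<open>t\<close> transpositions (\<open>card_perms_with_le\<close>). Permutations for which both numbers are at most
\<open>K\<close>, of order \<open>ln n\<close>, contribute at most \<open>n! exp(\<beta> K^2) = n! (1 + o(1))\<close>. For the
others the factor \<open>1/t!\<close> controls large \<open>t\<close>, and it remains to see that the numbers
\<open>g(f) = exp(\<beta> (f choose 2))/f!\<close> with \<open>K < f \<le> n\<close> have sum \<open>o(1)\<close>. They first
decrease and then increase (\<open>fixed_point_term_le_max\<close>), so up to \<open>f = n - 2\<close> the two ends
dominate: \<open>g(K)\<close> is small because of \<open>K!\<close>, and \<open>g(n - 2)\<close> is of order \<open>n^(-2)\<close>
and \<open>g(n - 1)\<close> of order \<open>1/n\<close> at the critical \<open>\<beta>\<close>. The last term \<open>g(n)\<close> is the
identity; it alone feels the distance from the critical value, and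
\<open>\<omega>(n) \<longlongrightarrow> \<infinity>\<close> makes it tend to \<open>0\<close> (\<open>fixed_point_term_self_tendsto_0\<close>).\<close>

section \<open>Counting permutations by fixed points and transpositions\<close>

definition fixed_points :: "'a set \<Rightarrow> ('a \<Rightarrow> 'a) \<Rightarrow> 'a set" where
  "fixed_points A \<sigma> = {x \<in> A. \<sigma> x = x}"

definition two_cycle_points :: "'a set \<Rightarrow> ('a \<Rightarrow> 'a) \<Rightarrow> 'a set" where
  "two_cycle_points A \<sigma> = {x \<in> A. \<sigma> x \<noteq> x \<and> \<sigma> (\<sigma> x) = x}"

text \<open>Counting points on 2-cycles rather than the cycles themselves makes the number visibly the same
for \<open>\<sigma>\<close> and \<open>inv \<sigma>\<close> and lets the double counting below run over points.\<close>
definition num_two_cycles :: "'a set \<Rightarrow> ('a \<Rightarrow> 'a) \<Rightarrow> nat" where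
  "num_two_cycles A \<sigma> = card (two_cycle_points A \<sigma>) div 2"

definition perm_weight :: "'a set \<Rightarrow> ('a \<Rightarrow> 'a) \<Rightarrow> nat" where
  "perm_weight A \<sigma> = (card (fixed_points A \<sigma>) choose 2) + num_two_cycles A \<sigma>"

definition perms_with :: "'a set \<Rightarrow> nat \<Rightarrow> nat \<Rightarrow> ('a \<Rightarrow> 'a) set" where
  "perms_with A f t =
     {\<sigma>. \<sigma> permutes A \<and> card (fixed_points A \<sigma>) = f \<and> num_two_cycles A \<sigma> = t}"

lemma finite_fixed_points [simp]: "finite A \<Longrightarrow> finite (fixed_points A \<sigma>)"
  by (simp add: fixed_points_def)

lemma finite_two_cycle_points [simp]: "finite A \<Longrightarrow> finite (two_cycle_points A \<sigma>)"
  by (simp add: two_cycle_points_def)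

lemma finite_perms_with: "finite A \<Longrightarrow> finite (perms_with A f t)"
  unfolding perms_with_def by (rule finite_subset[OF _ finite_permutations]) auto

lemma perms_with_remove_fixed_point:
  assumes A: "finite A" and \<sigma>: "\<sigma> \<in> perms_with A (Suc f) t" and x: "x \<in> fixed_points A \<sigma>"
  shows "\<sigma> \<in> perms_with (A - {x}) f t"
proof -
  have p: "\<sigma> permutes A" using \<sigma> by (simp add: perms_with_def)
  have xA: "x \<in> A" "\<sigma> x = x" using x by (auto simp: fixed_points_def)
  have "\<sigma> permutes (A - {x})"
    using p by (rule permutes_superset) (use xA in auto)
  moreover have "fixed_points (A - {x}) \<sigma> = fixed_points A \<sigma> - {x}"
    by (auto simp: fixed_points_def)
  moreover have "two_cycle_points (A - {x}) \<sigma> = two_cycle_points A \<sigma>"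
    using xA by (auto simp: two_cycle_points_def)
  ultimately show ?thesis
    using \<sigma> x A by (simp add: perms_with_def num_two_cycles_def)
qed

text \<open>Composing with the transposition \<open>(x \<sigma>(x))\<close> turns the two points of the cycle into fixed
points; restricting to the other points then forgets exactly this cycle.\<close>
lemma perms_with_remove_two_cycle:
  assumes A: "finite A" and \<sigma>: "\<sigma> \<in> perms_with A f (Suc t)" and x: "x \<in> two_cycle_points A \<sigma>"
  shows "\<sigma> \<circ> transpose x (\<sigma> x) \<in> perms_with (A - {x, \<sigma> x}) f t"
proof -
  define y where "y = \<sigma> x"
  define \<sigma>' where "\<sigma>' = \<sigma> \<circ> transpose x y"
  have p: "\<sigma> permutes A" using \<sigma> by (simp add: perms_with_def)
  have xA: "x \<in> A" "y \<in> A" "y \<noteq> x" "\<sigma> y = x" "\<sigma> x = y"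
    using x p by (auto simp: two_cycle_points_def y_def permutes_in_image)
  have inj: "\<sigma> u = \<sigma> v \<longleftrightarrow> u = v" for u v
    using permutes_inj[OF p] by (auto dest: injD)
  have v: "\<sigma>' x = x" "\<sigma>' y = y"
    using xA by (auto simp: \<sigma>'_def)
  have v': "\<sigma>' z = \<sigma> z" if "z \<noteq> x" "z \<noteq> y" for z
    using that by (auto simp: \<sigma>'_def transpose_def)
  have ne: "\<sigma> z \<noteq> x" "\<sigma> z \<noteq> y" if "z \<noteq> x" "z \<noteq> y" for z
    using that xA inj by metis+
  have "\<sigma>' permutes A"
    unfolding \<sigma>'_def by (intro permutes_compose p permutes_swap_id xA)
  hence "\<sigma>' permutes (A - {x, y})"
    by (rule permutes_superset) (use v in auto)
  moreover have "fixed_points (A - {x, y}) \<sigma>' = fixed_points A \<sigma>"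
  proof -
    have "z \<noteq> x \<and> z \<noteq> y" if "\<sigma> z = z" for z using that xA by metis
    thus ?thesis using v' by (auto simp: fixed_points_def)
  qed
  moreover have "two_cycle_points (A - {x, y}) \<sigma>' = two_cycle_points A \<sigma> - {x, y}"
    using v' ne by (auto simp: two_cycle_points_def)
  moreover have "{x, y} \<subseteq> two_cycle_points A \<sigma>"
    using xA by (auto simp: two_cycle_points_def)
  ultimately show ?thesis
    using \<sigma> A xA unfolding \<sigma>'_def y_def
    by (auto simp add: perms_with_def num_two_cycles_def card_Diff_subset)
qed

text \<open>Double counting of the pairs of a permutation and one of its fixed points.\<close>
lemma card_perms_with_Suc_fixed:
  assumes A: "finite A"
  shows "Suc f * card (perms_with A (Suc f) t) \<le> (\<Sum>x\<in>A. card (perms_with (A - {x}) f t))"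
proof -
  let ?S = "SIGMA \<sigma>:perms_with A (Suc f) t. fixed_points A \<sigma>"
  let ?T = "SIGMA x:A. perms_with (A - {x}) f t"
  have "Suc f * card (perms_with A (Suc f) t)
        = (\<Sum>\<sigma>\<in>perms_with A (Suc f) t. card (fixed_points A \<sigma>))"
    by (simp add: perms_with_def)
  also have "\<dots> = card ?S"
    using A by (simp add: card_SigmaI finite_perms_with)
  also have "\<dots> \<le> card ?T"
  proof (rule card_inj_on_le)
    show "inj_on prod.swap ?S" by simp
    show "prod.swap ` ?S \<subseteq> ?T"
    proof clarsimp
      fix \<sigma> x assume "\<sigma> \<in> perms_with A (Suc f) t" and x: "x \<in> fixed_points A \<sigma>"
      then have "\<sigma> \<in> perms_with (A - {x}) f t" by (intro perms_with_remove_fixed_point A)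
      thus "x \<in> A \<and> \<sigma> \<in> perms_with (A - {x}) f t"
        using x by (simp add: fixed_points_def)
    qed
    show "finite ?T" using A by (simp add: finite_perms_with)
  qed
  also have "\<dots> = (\<Sum>x\<in>A. card (perms_with (A - {x}) f t))"
    using A by (simp add: card_SigmaI finite_perms_with)
  finally show ?thesis .
qed

text \<open>Double counting of the pairs of a permutation and a point \<open>x\<close> on one of its 2-cycles. Such a
permutation is recovered from \<open>x\<close>, \<open>y = \<sigma>(x)\<close> and its restriction to the points other than
\<open>x\<close> and \<open>y\<close>. The cycles are counted with both orientations, which is where the factor
\<open>2\<close> comes from.\<close>
lemma card_perms_with_Suc_two_cycle:
  assumes A: "finite A"
  shows "2 * Suc t * card (perms_with A f (Suc t))
         \<le> (\<Sum>(x, y)\<in>(SIGMA x:A. A - {x}). card (perms_with (A - {x, y}) f t))"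
proof -
  let ?S = "SIGMA \<sigma>:perms_with A f (Suc t). two_cycle_points A \<sigma>"
  let ?P = "SIGMA x:A. A - {x}"
  let ?T = "SIGMA p:?P. perms_with (A - {fst p, snd p}) f t"
  let ?g = "\<lambda>(\<sigma>, x). ((x, \<sigma> x), \<sigma> \<circ> transpose x (\<sigma> x))"
  have "2 * Suc t * card (perms_with A f (Suc t))
        = (\<Sum>\<sigma>\<in>perms_with A f (Suc t). 2 * Suc t)"
    by simp
  also have "\<dots> \<le> (\<Sum>\<sigma>\<in>perms_with A f (Suc t). card (two_cycle_points A \<sigma>))"
    by (rule sum_mono) (auto simp: perms_with_def num_two_cycles_def)
  also have "\<dots> = card ?S"
    using A by (simp add: card_SigmaI finite_perms_with)
  also have "\<dots> \<le> card ?T"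
  proof (rule card_inj_on_le)
    show "inj_on ?g ?S"
    proof (rule inj_onI, clarsimp)
      fix \<sigma> \<sigma>' x
      assume "\<sigma> \<circ> transpose x (\<sigma>' x) = \<sigma>' \<circ> transpose x (\<sigma>' x)"
      hence "\<sigma> \<circ> (transpose x (\<sigma>' x) \<circ> transpose x (\<sigma>' x)) = \<sigma>' \<circ> (transpose x (\<sigma>' x) \<circ> transpose x (\<sigma>' x))"
        by (simp only: o_assoc)
      thus "\<sigma> = \<sigma>'" by simp
    qed
    show "?g ` ?S \<subseteq> ?T"
    proof clarsimp
      fix \<sigma> x assume s: "\<sigma> \<in> perms_with A f (Suc t)" and x: "x \<in> two_cycle_points A \<sigma>"
      then have "\<sigma> \<circ> transpose x (\<sigma> x) \<in> perms_with (A - {x, \<sigma> x}) f t"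
        by (intro perms_with_remove_two_cycle A)
      moreover have "x \<in> A" "\<sigma> x \<in> A" "\<sigma> x \<noteq> x"
        using x s by (auto simp: two_cycle_points_def perms_with_def permutes_in_image)
      ultimately show "x \<in> A \<and> \<sigma> x \<in> A \<and> \<sigma> x \<noteq> x \<and>
          \<sigma> \<circ> transpose x (\<sigma> x) \<in> perms_with (A - {x, \<sigma> x}) f t"
        by simp
    qed
    show "finite ?T" using A by (simp add: finite_perms_with)
  qed
  also have "\<dots> = (\<Sum>(x, y)\<in>?P. card (perms_with (A - {x, y}) f t))"
    using A by (subst card_SigmaI) (auto simp: finite_perms_with case_prod_beta)
  finally show ?thesis .
qed

text \<open>The factor \<open>f! 2^t t!\<close> is the number of ways to list the fixed points and the 2-cycles, each
cycle with a chosen first point. Removing the listed items one at a time leaves at most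
\<open>n (n - 1) \<dots>\<close> choices of points and a permutation of the rest, hence at most \<open>n!\<close>
possibilities.\<close>
lemma card_perms_with_le:
  assumes "finite A"
  shows "fact f * (2 ^ t * fact t) * card (perms_with A f t) \<le> fact (card A)"
  using assms
proof (induction f arbitrary: A)
  case 0
  then show ?case
  proof (induction t arbitrary: A)
    case 0
    have "card (perms_with A 0 0) \<le> card {\<sigma>. \<sigma> permutes A}"
      using 0 by (intro card_mono finite_permutations) (auto simp: perms_with_def)
    also have "\<dots> = fact (card A)" by (intro card_permutations 0 refl)
    finally show ?case by simp
  next
    case (Suc t)
    let ?P = "SIGMA x:A. A - {x}"
    have "fact 0 * (2 ^ Suc t * fact (Suc t)) * card (perms_with A 0 (Suc t))
          = 2 ^ t * fact t * (2 * Suc t * card (perms_with A 0 (Suc t)))"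
      by (simp add: algebra_simps)
    also have "\<dots> \<le> 2 ^ t * fact t * (\<Sum>(x, y)\<in>?P. card (perms_with (A - {x, y}) 0 t))"
      by (intro mult_left_mono card_perms_with_Suc_two_cycle Suc.prems) auto
    also have "\<dots> = (\<Sum>(x, y)\<in>?P. 2 ^ t * fact t * card (perms_with (A - {x, y}) 0 t))"
      by (simp add: sum_distrib_left case_prod_beta)
    also have "\<dots> \<le> (\<Sum>(x, y)\<in>?P. fact (card A - 2))"
    proof (rule sum_mono)
      fix p assume p: "p \<in> ?P"
      obtain x y where xy: "p = (x, y)" "x \<in> A" "y \<in> A" "y \<noteq> x"
        using p by auto
      hence "card (A - {x, y}) = card A - 2"
        using Suc.prems by (subst card_Diff_subset) auto
      thus "(case p of (x, y) \<Rightarrow> 2 ^ t * fact t * card (perms_with (A - {x, y}) 0 t))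
          \<le> (case p of (x, y) \<Rightarrow> fact (card A - 2))"
        using Suc.IH[of "A - {x, y}"] Suc.prems xy by simp
    qed
    also have "\<dots> = card A * (card A - 1) * fact (card A - 2)"
      using Suc.prems by (simp add: case_prod_beta card_SigmaI)
    also have "\<dots> \<le> fact (card A)"
      by (cases "card A"; cases "card A - 1") (auto simp: algebra_simps)
    finally show ?case .
  qed
next
  case (Suc f)
  have "fact (Suc f) * (2 ^ t * fact t) * card (perms_with A (Suc f) t)
        = fact f * (2 ^ t * fact t) * (Suc f * card (perms_with A (Suc f) t))"
    by (simp add: algebra_simps)
  also have "\<dots> \<le> fact f * (2 ^ t * fact t) * (\<Sum>x\<in>A. card (perms_with (A - {x}) f t))"
    by (intro mult_left_mono card_perms_with_Suc_fixed Suc.prems) auto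
  also have "\<dots> = (\<Sum>x\<in>A. fact f * (2 ^ t * fact t) * card (perms_with (A - {x}) f t))"
    by (simp add: sum_distrib_left)
  also have "\<dots> \<le> (\<Sum>x\<in>A. fact (card A - 1))"
    using Suc.IH Suc.prems by (intro sum_mono) (metis card_Diff_singleton finite_Diff)
  also have "\<dots> = card A * fact (card A - 1)" by simp
  also have "\<dots> \<le> fact (card A)"
    by (cases "card A") auto
  finally show ?case .
qed

lemma fixed_points_inv:
  assumes "\<sigma> permutes A"
  shows "fixed_points A (inv \<sigma>) = fixed_points A \<sigma>"
  unfolding fixed_points_def using permutes_inverses[OF assms] by metis

lemma two_cycle_points_inv:
  assumes "\<sigma> permutes A"
  shows "two_cycle_points A (inv \<sigma>) = two_cycle_points A \<sigma>"
  unfolding two_cycle_points_def using permutes_inverses[OF assms] by metis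

lemma perm_weight_inv:
  "\<sigma> permutes A \<Longrightarrow> perm_weight A (inv \<sigma>) = perm_weight A \<sigma>"
  by (simp add: perm_weight_def num_two_cycles_def fixed_points_inv two_cycle_points_inv)

text \<open>Orbits of size 2 are disjoint and consist of points on 2-cycles.\<close>
lemma num_transpositions_le:
  assumes p: "p permutes {1..n}"
  shows "num_transpositions n p \<le> num_two_cycles {1..n} p"
proof -
  let ?C = "{C \<in> orbit p ` {1..n}. card C = 2}"
  have perm: "permutation p" using p by (auto simp: permutation_permutes)
  have cyc: "cyclic_on p (orbit p x)" for x
    using perm by (rule cyclic_on_orbit')
  have eq: "orbit p y = orbit p x" if "y \<in> orbit p x" for x y
    using orbit_cyclic_eq3[OF cyc that] by simp
  have sub: "\<Union>?C \<subseteq> two_cycle_points {1..n} p"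
  proof clarsimp
    fix y x assume y: "y \<in> orbit p x" and x: "Suc 0 \<le> x" "x \<le> n" and c: "card (orbit p x) = 2"
    have yn: "y \<in> {1..n}"
      using permutes_orbit_subset[OF p, of x] x y by auto
    have o: "orbit p y = orbit p x" using eq[OF y] .
    have ne: "p y \<noteq> y"
    proof
      assume "p y = y"
      hence "orbit p y = {y}" by (simp add: orbit_eq_singleton_iff)
      thus False using o c by simp
    qed
    have m: "y \<in> orbit p x" "p y \<in> orbit p x" "p (p y) \<in> orbit p x"
      using y by (auto intro: orbit.step)
    moreover have "card {y, p y} = 2" using ne by simp
    moreover have "finite (orbit p x)" using c by (intro card_ge_0_finite) simp
    ultimately have "orbit p x = {y, p y}" using c
      by (intro card_subset_eq[symmetric]) auto
    hence "p (p y) = y \<or> p (p y) = p y" using m by auto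
    hence "p (p y) = y" using ne permutes_inj[OF p] by (auto dest: injD)
    thus "y \<in> two_cycle_points {Suc 0..n} p" using ne yn by (auto simp: two_cycle_points_def)
  qed
  have "2 * card ?C = card (\<Union>?C)"
  proof (rule card_partition)
    show "finite (\<Union>?C)" by (rule finite_subset[OF sub]) simp
    fix c1 c2 assume c: "c1 \<in> ?C" "c2 \<in> ?C" "c1 \<noteq> c2"
    hence "c1 = c2" if "y \<in> c1" "y \<in> c2" for y
      using that eq by (smt (verit) imageE mem_Collect_eq)
    thus "c1 \<inter> c2 = {}" using c by blast
  qed auto
  also have "\<dots> \<le> card (two_cycle_points {1..n} p)"
    by (rule card_mono[OF _ sub]) simp
  finally show ?thesis by (simp add: num_transpositions_def num_two_cycles_def)
qed

lemma wt_pair_le: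
  assumes "\<pi> k permutes {1..n}" "\<pi> l permutes {1..n}"
  shows "wt_pair n \<pi> k l \<le> perm_weight {1..n} (inv (\<pi> k) \<circ> \<pi> l)"
  using num_transpositions_le[OF permutes_compose[OF assms(2) permutes_inv[OF assms(1)]]]
  by (simp add: wt_pair_def perm_weight_def rel_perm_def num_fixed_def fixed_points_def)

section \<open>The sum over single permutations\<close>

text \<open>Up to the factor \<open>n!\<close>, this bounds the contribution of the permutations with \<open>f\<close> fixed
points, transpositions left aside.\<close>
definition fixed_point_term :: "real \<Rightarrow> nat \<Rightarrow> real" where
  "fixed_point_term \<beta> f = exp (\<beta> * real (f choose 2)) / fact f"

lemma fixed_point_term_nonneg [simp]: "fixed_point_term \<beta> f \<ge> 0"
  by (simp add: fixed_point_term_def)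

lemma fixed_point_term_mono: "\<beta> \<le> \<beta>' \<Longrightarrow> fixed_point_term \<beta> f \<le> fixed_point_term \<beta>' f"
  by (simp add: fixed_point_term_def divide_right_mono mult_right_mono)

lemma fixed_point_term_Suc:
  "fixed_point_term \<beta> (Suc f) = fixed_point_term \<beta> f * (exp (\<beta> * f) / real (Suc f))"
proof -
  have "real (Suc f choose 2) = real (f choose 2) + real f"
    by (simp add: numeral_2_eq_2)
  thus ?thesis
    by (simp add: fixed_point_term_def field_simps exp_add)
qed

text \<open>The ratio of consecutive terms is \<open>exp(\<beta> f)/(f + 1)\<close>, and it is at least \<open>1\<close> iff
\<open>ln(f + 1)/f \<le> \<beta>\<close>. The left-hand side decreases in \<open>f\<close>, so once the terms grow
they keep growing. The case \<open>f = 0\<close> has to be left out: there the ratio is \<open>1\<close> for every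
\<open>\<beta>\<close>, while the next one is \<open>exp(\<beta>)/2\<close>.\<close>
lemma increasing_ratio_propagates:
  assumes "1 \<le> f" "real (Suc f) \<le> exp (\<beta> * real f)"
  shows "real (Suc (Suc f)) \<le> exp (\<beta> * real (Suc f))"
proof -
  have f: "real f \<ge> 1" using assms by simp
  \<comment> \<open>\<open>ln(f + 1)/f\<close> is decreasing: by \<open>ln x \<le> x - 1\<close>, \<open>f ln(f + 2)\<close> exceeds
      \<open>f ln(f + 1)\<close> by at most \<open>f/(f + 1)\<close>, which is at most \<open>ln(f + 1)\<close>.\<close>
  have "real f / (real f + 1) = 1 - 1 / (real f + 1)" by (simp add: field_simps)
  also have "\<dots> \<le> ln (real f + 1)"
    using ln_le_minus_one[of "1 / (real f + 1)"] f by (simp add: ln_div)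
  finally have 1: "real f / (real f + 1) \<le> ln (real f + 1)" .
  have "ln (real f + 2) - ln (real f + 1) \<le> 1 / (real f + 1)"
    using ln_diff_le[of "real f + 2" "real f + 1"] f by simp
  hence "real f * (ln (real f + 2) - ln (real f + 1)) \<le> real f / (real f + 1)"
    using f mult_left_mono[of _ "1 / (real f + 1)" "real f"] by simp
  with 1 have "real f * ln (real f + 2) \<le> (real f + 1) * ln (real f + 1)"
    by (simp add: algebra_simps)
  also have "ln (real f + 1) \<le> \<beta> * real f"
    using ln_mono[OF assms(2)] f by (simp add: add.commute)
  hence "(real f + 1) * ln (real f + 1) \<le> (real f + 1) * (\<beta> * real f)"
    by (intro mult_left_mono) auto
  finally have "real f * ln (real f + 2) \<le> real f * (\<beta> * (real f + 1))"
    by (simp add: algebra_simps)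
  hence le: "ln (real f + 2) \<le> \<beta> * (real f + 1)" using f by simp
  have "real (Suc (Suc f)) = exp (ln (real f + 2))" by simp
  also have "\<dots> \<le> exp (\<beta> * real (Suc f))"
    unfolding exp_le_cancel_iff using le by (simp add: add.commute)
  finally show ?thesis .
qed

text \<open>A sequence that first decreases and then increases is largest at an end of any interval.\<close>
lemma fixed_point_term_le_max:
  assumes "1 \<le> a" "a \<le> f" "f \<le> b"
  shows "fixed_point_term \<beta> f \<le> max (fixed_point_term \<beta> a) (fixed_point_term \<beta> b)"
proof -
  define up where "up f \<longleftrightarrow> real (Suc f) \<le> exp (\<beta> * real f)" for f
  have step: "up f \<Longrightarrow> fixed_point_term \<beta> f \<le> fixed_point_term \<beta> (Suc f)"
    "\<not> up f \<Longrightarrow> fixed_point_term \<beta> (Suc f) \<le> fixed_point_term \<beta> f" for f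
    unfolding up_def fixed_point_term_Suc
    using mult_left_mono[of 1 "exp (\<beta> * f) / real (Suc f)" "fixed_point_term \<beta> f"]
      mult_left_mono[of "exp (\<beta> * f) / real (Suc f)" 1 "fixed_point_term \<beta> f"]
    by (simp_all add: field_simps del: of_nat_Suc)
  have up_mono: "up g'" if "g \<le> g'" "up g" "1 \<le> g" for g g'
    using that
  proof (induction rule: dec_induct)
    case (step k)
    thus ?case using increasing_ratio_propagates[of k \<beta>] by (simp add: up_def)
  qed
  show ?thesis
  proof (cases "up f")
    case True
    have "fixed_point_term \<beta> f \<le> fixed_point_term \<beta> b"
      using assms(3)
    proof (induction rule: dec_induct)
      case (step k)
      have "up k" using up_mono[of f k] True step assms by simp
      thus ?case using step.IH \<open>\<And>f. up f \<Longrightarrow> _ f\<close>[of k] by simp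
    qed simp
    thus ?thesis by simp
  next
    case False
    have "fixed_point_term \<beta> f \<le> fixed_point_term \<beta> a"
      using assms(2)
    proof (induction rule: inc_induct)
      case (step k)
      have "\<not> up k" using up_mono[of k f] False step assms by auto
      thus ?case using step.IH \<open>\<And>f. \<not> up f \<Longrightarrow> _ f\<close>[of k] by simp
    qed simp
    thus ?thesis by simp
  qed
qed

definition perm_partition_sum :: "real \<Rightarrow> nat \<Rightarrow> real" where
  "perm_partition_sum \<beta> n =
     (\<Sum>\<sigma> | \<sigma> permutes {1..n}. exp (\<beta> * real (perm_weight {1..n} \<sigma>)))"

lemma sum_inverse_fact_le: "finite A \<Longrightarrow> (\<Sum>t\<in>A. 1 / fact t) \<le> exp (1::real)"
  using sum_le_suminf[OF summable_exp[of "1::real"], of A]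
  by (simp add: exp_def field_simps)

lemma perm_partition_sum_ge:
  assumes "\<beta> \<ge> 0" shows "fact n \<le> perm_partition_sum \<beta> n"
proof -
  have "fact n = (\<Sum>\<sigma> | \<sigma> permutes {1..n}. 1 :: real)"
    by (simp add: card_permutations[of _ n])
  also have "\<dots> \<le> perm_partition_sum \<beta> n"
    unfolding perm_partition_sum_def using assms by (intro sum_mono) simp
  finally show ?thesis .
qed

text \<open>The condition \<open>exp \<beta> \<le> 2\<close> lets the factor \<open>2^t\<close> of the counting bound absorb the weight
\<open>exp(\<beta> t)\<close> of the transpositions.\<close>
lemma sum_perms_with_le:
  assumes \<beta>: "0 \<le> \<beta>" "exp \<beta> \<le> 2"
  shows "(\<Sum>\<sigma>\<in>perms_with {1..n} f t. exp (\<beta> * real (perm_weight {1..n} \<sigma>)))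
         \<le> fact n * (fixed_point_term \<beta> f * (1 / fact t))"
proof -
  let ?N = "card (perms_with {1..n} f t)"
  have "real (fact f * (2 ^ t * fact t) * ?N) \<le> real (fact n)"
    using card_perms_with_le[of "{1..n}" f t] unfolding of_nat_le_iff by simp
  hence N: "real ?N \<le> fact n / (fact f * (2 ^ t * fact t))"
    by (simp add: field_simps)
  have "(\<Sum>\<sigma>\<in>perms_with {1..n} f t. exp (\<beta> * real (perm_weight {1..n} \<sigma>)))
      = real ?N * (exp (\<beta> * real (f choose 2)) * exp \<beta> ^ t)"
    by (simp add: perms_with_def perm_weight_def distrib_left exp_add exp_of_nat2_mult)
  also have "\<dots> \<le> fact n / (fact f * (2 ^ t * fact t)) * (exp (\<beta> * real (f choose 2)) * 2 ^ t)"
    using \<beta> by (intro mult_mono N power_mono) auto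
  also have "\<dots> = fact n * (fixed_point_term \<beta> f * (1 / fact t))"
    by (simp add: fixed_point_term_def)
  finally show ?thesis .
qed

text \<open>The term \<open>E\<close> comes from the permutations with at most \<open>K\<close> fixed points and at most \<open>K\<close>
transpositions: these are at most \<open>n!\<close> in number, and using this instead of the bound
\<open>n!/(f! 2^t t!)\<close> gives the leading constant \<open>1\<close>. The term \<open>G e\<close> comes from those with
more than \<open>K\<close> fixed points, since the sum of \<open>1/t!\<close> is at most \<open>e\<close>, and the last one
from those with more than \<open>K\<close> transpositions.\<close>
lemma perm_partition_sum_le:
  fixes n K :: nat
  assumes \<beta>: "0 \<le> \<beta>" "exp \<beta> \<le> 2" and K: "1 \<le> K"
  defines "E \<equiv> exp (\<beta> * real K ^ 2)" and "G \<equiv> (\<Sum>f\<in>{K<..n}. fixed_point_term \<beta> f)"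
  shows "perm_partition_sum \<beta> n
         \<le> fact n * (E + G * exp 1 + (E * exp 1 + G) * (real n / fact K))"
proof -
  define w where "w \<sigma> = exp (\<beta> * real (perm_weight {1..n} \<sigma>))" for \<sigma>
  let ?P = "{\<sigma>. \<sigma> permutes {1..n}}"
  let ?g = "fixed_point_term \<beta>"
  define S where "S = {\<sigma>\<in>?P. card (fixed_points {1..n} \<sigma>) \<le> K \<and> num_two_cycles {1..n} \<sigma> \<le> K}"
  define I where "I = {K<..n} \<times> {..n} \<union> {..n} \<times> {K<..n}"
  have fin: "finite ?P" by (rule finite_permutations) simp
  \<comment> \<open>The term \<open>- \<beta> K\<close> leaves room for the weight of up to \<open>K\<close> transpositions.\<close>
  have exp_le: "\<beta> * real (f choose 2) \<le> \<beta> * real K ^ 2 - \<beta> * real K" if "f \<le> K" for f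
  proof -
    have "f choose 2 \<le> K choose 2" using that by (rule binomial_right_mono)
    also have "\<dots> \<le> K * (K - 1)" by (simp add: choose_two)
    finally have "real (f choose 2) \<le> real (K * (K - 1))" by (simp only: of_nat_le_iff)
    also have "\<dots> = real K ^ 2 - real K" using K by (simp add: of_nat_diff power2_eq_square algebra_simps)
    finally show ?thesis using \<beta> mult_left_mono by (fastforce simp: algebra_simps)
  qed
  have le_n: "card (fixed_points {1..n} \<sigma>) \<le> n" "num_two_cycles {1..n} \<sigma> \<le> n" for \<sigma>
  proof -
    have "card (fixed_points {1..n} \<sigma>) \<le> card {1..n}" "card (two_cycle_points {1..n} \<sigma>) \<le> card {1..n}"
      by (rule card_mono; auto simp: fixed_points_def two_cycle_points_def)+
    thus "card (fixed_points {1..n} \<sigma>) \<le> n" "num_two_cycles {1..n} \<sigma> \<le> n"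
      by (auto simp: num_two_cycles_def)
  qed
  have "(\<Sum>\<sigma>\<in>S. w \<sigma>) \<le> (\<Sum>\<sigma>\<in>S. E)"
  proof (rule sum_mono)
    fix \<sigma> assume "\<sigma> \<in> S"
    hence "\<beta> * real (card (fixed_points {1..n} \<sigma>) choose 2) \<le> \<beta> * real K ^ 2 - \<beta> * real K"
      "\<beta> * real (num_two_cycles {1..n} \<sigma>) \<le> \<beta> * real K"
      using \<beta> by (auto simp: S_def intro!: exp_le mult_left_mono)
    thus "w \<sigma> \<le> E" by (simp add: w_def E_def perm_weight_def distrib_left)
  qed
  also have "\<dots> \<le> fact n * E"
  proof -
    have "card S \<le> card ?P" by (rule card_mono[OF fin]) (auto simp: S_def)
    also have "\<dots> = fact n" by (rule card_permutations) auto
    finally have "real (card S) \<le> real (fact n)" by (simp only: of_nat_le_iff)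
    thus ?thesis by (simp add: E_def)
  qed
  finally have main: "(\<Sum>\<sigma>\<in>S. w \<sigma>) \<le> fact n * E" .
  have "(\<Sum>\<sigma>\<in>?P - S. w \<sigma>) \<le> (\<Sum>\<sigma>\<in>(\<Union>(f, t)\<in>I. perms_with {1..n} f t). w \<sigma>)"
  proof (rule sum_mono2)
    show "finite (\<Union>(f, t)\<in>I. perms_with {1..n} f t)"
      by (auto simp: I_def finite_perms_with)
    show "?P - S \<subseteq> (\<Union>(f, t)\<in>I. perms_with {1..n} f t)"
      using le_n by (auto simp: S_def I_def perms_with_def)
  qed (auto simp: w_def)
  also have "\<dots> = (\<Sum>(f, t)\<in>I. \<Sum>\<sigma>\<in>perms_with {1..n} f t. w \<sigma>)"
    unfolding case_prod_beta
  proof (rule sum.UNION_disjoint)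
    show "finite I" by (simp add: I_def)
    show "\<forall>i\<in>I. finite (perms_with {1..n} (fst i) (snd i))" by (simp add: finite_perms_with)
  qed (auto simp: perms_with_def)
  also have "\<dots> \<le> (\<Sum>(f, t)\<in>I. fact n * (?g f * (1 / fact t)))"
    unfolding w_def by (intro sum_mono) (use sum_perms_with_le[OF \<beta>] in auto)
  also have "\<dots> = fact n * (\<Sum>(f, t)\<in>I. ?g f * (1 / fact t))"
    by (simp add: sum_distrib_left case_prod_beta)
  also have "(\<Sum>(f, t)\<in>I. ?g f * (1 / fact t))
      \<le> (\<Sum>(f, t)\<in>{K<..n} \<times> {..n}. ?g f * (1 / fact t)) + (\<Sum>(f, t)\<in>{..n} \<times> {K<..n}. ?g f * (1 / fact t))"
    unfolding I_def by (subst sum.union_inter[symmetric]) (auto intro!: sum_nonneg)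
  also have "\<dots> = G * (\<Sum>t\<le>n. 1 / fact t) + (\<Sum>f\<le>n. ?g f) * (\<Sum>t\<in>{K<..n}. 1 / fact t)"
    by (simp only: sum_product sum.cartesian_product G_def)
  also have "\<dots> \<le> G * exp 1 + (E * exp 1 + G) * (real n / fact K)"
  proof (intro add_mono mult_mono)
    show "(\<Sum>t\<le>n. 1 / fact t) \<le> exp (1::real)" by (rule sum_inverse_fact_le) simp
    have "(\<Sum>f\<le>n. ?g f) \<le> (\<Sum>f\<in>{..K} \<union> {K<..n}. ?g f)"
      by (rule sum_mono2) auto
    also have "\<dots> = (\<Sum>f\<le>K. ?g f) + G"
      unfolding G_def by (rule sum.union_disjoint) auto
    also have "(\<Sum>f\<le>K. ?g f) \<le> (\<Sum>f\<le>K. E * (1 / fact f))"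
    proof (rule sum_mono)
      fix f assume "f \<in> {..K}"
      hence "\<beta> * real (f choose 2) \<le> \<beta> * real K ^ 2 - \<beta> * real K" by (intro exp_le) auto
      also have "\<dots> \<le> \<beta> * real K ^ 2" using \<beta> by simp
      finally show "?g f \<le> E * (1 / fact f)"
        by (simp add: fixed_point_term_def E_def divide_right_mono)
    qed
    also have "\<dots> = E * (\<Sum>f\<le>K. 1 / fact f)" by (simp add: sum_distrib_left)
    also have "\<dots> \<le> E * exp 1"
      by (intro mult_left_mono sum_inverse_fact_le) (auto simp: E_def)
    finally show "(\<Sum>f\<le>n. ?g f) \<le> E * exp 1 + G" by simp
    have "(\<Sum>t\<in>{K<..n}. 1 / fact t) \<le> (\<Sum>t\<in>{K<..n}. 1 / fact K :: real)"
      by (intro sum_mono divide_left_mono fact_mono) auto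
    also have "\<dots> \<le> real n / fact K" by (simp add: divide_right_mono)
    finally show "(\<Sum>t\<in>{K<..n}. 1 / fact t) \<le> real n / fact K" .
  qed (auto simp: G_def E_def intro!: sum_nonneg add_nonneg_nonneg)
  finally have tail: "(\<Sum>\<sigma>\<in>?P - S. w \<sigma>)
    \<le> fact n * (G * exp 1 + (E * exp 1 + G) * (real n / fact K))"
    by (simp add: mult_left_mono)
  have "perm_partition_sum \<beta> n = (\<Sum>\<sigma>\<in>S. w \<sigma>) + (\<Sum>\<sigma>\<in>?P - S. w \<sigma>)"
    unfolding perm_partition_sum_def w_def[symmetric]
    by (rule sum.subset_diff[OF _ fin, of S w, THEN trans]) (auto simp: S_def)
  also have "\<dots> \<le> fact n * E + fact n * (G * exp 1 + (E * exp 1 + G) * (real n / fact K))"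
    by (rule add_mono[OF main tail])
  also have "\<dots> = fact n * (E + G * exp 1 + (E * exp 1 + G) * (real n / fact K))"
    by (simp add: distrib_left)
  finally show ?thesis .
qed

section \<open>Asymptotics below the critical value\<close>

lemma ln_fact_le: "n \<ge> 1 \<Longrightarrow> ln (fact n) \<le> real n * ln (real n)"
proof -
  assume n: "n \<ge> 1"
  have "(fact n :: real) \<le> real n ^ n" using fact_le_power[of n] by simp
  hence "ln (fact n :: real) \<le> ln (real n ^ n)" using n by simp
  thus ?thesis using n by (simp add: ln_realpow)
qed

lemma ln_fact_ge: "n \<ge> 1 \<Longrightarrow> real n * (ln (real n) - 1) \<le> ln (fact n)"
proof -
  assume n: "n \<ge> 1"
  have "real n ^ n / fact n \<le> exp (real n)"
    using sum_le_suminf[OF summable_exp[of "real n"], of "{n}"]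
    by (simp add: exp_def field_simps)
  hence "real n ^ n \<le> exp (real n) * fact n" by (simp add: field_simps)
  hence "ln (real n ^ n) \<le> ln (exp (real n) * fact n)" using n by simp
  thus ?thesis using n by (simp add: ln_realpow ln_mult algebra_simps)
qed

text \<open>This makes \<open>K!\<close> exceed a given power of \<open>n\<close> once \<open>K\<close> is a large enough multiple of
\<open>ln n\<close>.\<close>
lemma exp_half_le_fact: "exp (real K / 2) \<le> 2 * fact K"
proof (induction K)
  case (Suc K)
  show ?case
  proof (cases K)
    case 0
    thus ?thesis using exp_half_le2 by simp
  next
    case (Suc k)
    have "exp (real (Suc K) / 2) = exp (1/2) * exp (real K / 2)"
      by (simp add: exp_add[symmetric] field_simps)
    also have "\<dots> \<le> real (Suc K) * (2 * fact K)"
      using Suc.IH Suc exp_half_le2 by (intro mult_mono) auto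
    finally show ?thesis by (simp add: algebra_simps)
  qed
qed auto

text \<open>The value of \<open>\<beta>\<close> at which the identity permutation alone weighs as much as all \<open>n!\<close>
permutations with \<open>\<beta> = 0\<close>. By Stirling it is about \<open>2 (ln n - 1)/n\<close>.\<close>
definition critical_beta :: "nat \<Rightarrow> real" where
  "critical_beta n = ln (fact n) / real (n choose 2)"

lemma real_choose_two: "real (n choose 2) = real n * (real n - 1) / 2"
  by (cases n) (auto simp: choose_two real_of_nat_div algebra_simps)

lemma critical_beta_eq: "critical_beta n = 2 * (ln (fact n) / real n) / (real n - 1)"
  by (simp add: critical_beta_def real_choose_two)

lemma critical_beta_le:
  assumes "n \<ge> 2" shows "critical_beta n \<le> 2 * ln (real n) / (real n - 1)"
  unfolding critical_beta_eq using ln_fact_le[of n] assms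
  by (intro divide_right_mono mult_left_mono) (auto simp: pos_divide_le_eq mult.commute)

lemma critical_beta_ge:
  assumes "n \<ge> 2" shows "2 * (ln (real n) - 1) / (real n - 1) \<le> critical_beta n"
  unfolding critical_beta_eq using ln_fact_ge[of n] assms
  by (intro divide_right_mono mult_left_mono) (auto simp: pos_le_divide_eq mult.commute)

text \<open>The terms near \<open>f = n\<close> are found by descending from \<open>f = n\<close>, where the term is \<open>1\<close> at
the critical value.\<close>
lemma fixed_point_term_pred:
  "fixed_point_term \<beta> f = fixed_point_term \<beta> (Suc f) * (real (Suc f) * exp (- (\<beta> * real f)))"
  by (simp add: fixed_point_term_Suc exp_minus del: of_nat_Suc)

lemma fixed_point_term_critical_self: "n \<ge> 2 \<Longrightarrow> fixed_point_term (critical_beta n) n = 1"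
  by (simp add: fixed_point_term_def critical_beta_def)

text \<open>The bound equals \<open>e^2/n\<close>.\<close>
lemma fixed_point_term_critical_pred:
  assumes "n \<ge> 2"
  shows "fixed_point_term (critical_beta n) (n - 1) \<le> real n * exp (- (2 * (ln (real n) - 1)))"
proof -
  have "fixed_point_term (critical_beta n) (n - 1)
      = real n * exp (- (critical_beta n * (real n - 1)))"
    using fixed_point_term_pred[of "critical_beta n" "n - 1"] assms
    by (simp add: fixed_point_term_critical_self of_nat_diff)
  also have "\<dots> \<le> real n * exp (- (2 * (ln (real n) - 1)))"
    using critical_beta_ge[OF assms] assms
    by (intro mult_left_mono) (auto simp: pos_divide_le_eq)
  finally show ?thesis .
qed

text \<open>The bound is of order \<open>n^(-2)\<close>, so that \<open>n\<close> terms of this size are still negligible.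
For \<open>f = n - 1\<close> this fails, which is why the two are treated apart.\<close>
lemma fixed_point_term_critical_pred2:
  assumes "n \<ge> 3"
  shows "fixed_point_term (critical_beta n) (n - 2)
    \<le> real n ^ 2 * exp (- (2 * (ln (real n) - 1) / (real n - 1) * (2 * real n - 3)))"
proof -
  let ?b = "critical_beta n"
  have S: "Suc (n - 2) = n - 1" "Suc (n - 1) = n" using assms by auto
  have "fixed_point_term ?b (n - 2)
      = (real n * exp (- (?b * (real n - 1)))) * ((real n - 1) * exp (- (?b * (real n - 2))))"
    using fixed_point_term_pred[of ?b "n - 1"] fixed_point_term_pred[of ?b "n - 2"] assms
    unfolding S by (simp add: fixed_point_term_critical_self of_nat_diff)
  also have "\<dots> = real n * (real n - 1) * exp (- (?b * (2 * real n - 3)))"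
    by (simp add: exp_add[symmetric] algebra_simps)
  also have "\<dots> \<le> real n ^ 2 * exp (- (2 * (ln (real n) - 1) / (real n - 1) * (2 * real n - 3)))"
  proof (intro mult_mono)
    show "real n * (real n - 1) \<le> real n ^ 2" by (simp add: power2_eq_square mult_left_mono)
    show "exp (- (?b * (2 * real n - 3)))
        \<le> exp (- (2 * (ln (real n) - 1) / (real n - 1) * (2 * real n - 3)))"
      unfolding exp_le_cancel_iff neg_le_iff_le
      using critical_beta_ge[of n] assms by (intro mult_right_mono) auto
  qed auto
  finally show ?thesis .
qed

text \<open>Write \<open>C = (n choose 2)\<close>, \<open>L = ln n!\<close> and \<open>\<delta> = \<omega>(n)/(ln n)^2\<close>. The logarithm of
the term is \<open>\<beta> C - L\<close>, and \<open>\<beta> \<le> 1/(C/L + \<delta>)\<close> makes it at most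
\<open>- \<delta> L^2/(C + \<delta> L)\<close>. As \<open>L\<close> is about \<open>n ln n\<close> and \<open>C\<close> about
\<open>n^2/2\<close>, for moderate \<open>\<omega>\<close> this bound is of order \<open>- \<omega>(n)\<close>: the correction
\<open>1/(ln n)^2\<close> in the hypothesis is exactly the scale on which the identity disappears.\<close>
lemma fixed_point_term_self_tendsto_0:
  fixes \<beta> \<omega> :: "nat \<Rightarrow> real"
  assumes \<omega>: "filterlim \<omega> at_top sequentially"
  assumes \<beta>: "eventually (\<lambda>n. 0 \<le> \<beta> n \<and>
      \<beta> n * (real (n choose 2) / ln (fact n) + \<omega> n / (ln (real n))\<^sup>2) \<le> 1) sequentially"
  shows "(\<lambda>n. fixed_point_term (\<beta> n) n) \<longlonglongrightarrow> 0"
proof -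
  have bound: "eventually (\<lambda>n. fixed_point_term (\<beta> n) n
      \<le> exp (- (\<omega> n / 4)) + exp (- (real n * (ln (real n) - 1) / 2))) sequentially"
    using \<beta> filterlim_at_top_dense[THEN iffD1, OF \<omega>, rule_format, of 0] eventually_ge_at_top[of "9::nat"]
  proof eventually_elim
    case (elim n)
    define C L \<delta> where "C = real (n choose 2)" and "L = ln (fact n :: real)"
      and "\<delta> = \<omega> n / (ln (real n))\<^sup>2"
    \<comment> \<open>For \<open>n \<ge> 9 \<ge> e^2\<close> the lower bound \<open>n (ln n - 1)\<close> for \<open>L\<close> is at least \<open>n (ln n)/2\<close>.\<close>
    have "exp 2 \<le> (9::real)" using exp_le power_mono[of "exp 1::real" 3 2]
      by (simp add: exp_of_nat_mult[symmetric] flip: exp_double)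
    also have "\<dots> \<le> real n" using elim by simp
    finally have ln2: "ln (real n) \<ge> 2" using elim by (simp add: ln_ge_iff)
    have L: "L \<ge> real n * (ln (real n) - 1)" "L > 0"
    proof -
      show "L \<ge> real n * (ln (real n) - 1)" using ln_fact_ge[of n] elim by (simp add: L_def)
      moreover have "real n * (ln (real n) - 1) > 0" using ln2 elim by simp
      ultimately show "L > 0" by linarith
    qed
    have C: "C > 0" "2 * C \<le> real n ^ 2"
      using elim by (simp_all add: C_def real_choose_two power2_eq_square)
    have \<delta>: "\<delta> > 0" using elim ln2 by (simp add: \<delta>_def)
    have "\<beta> n * (C / L + \<delta>) \<le> 1" using elim by (simp add: C_def L_def \<delta>_def)
    hence "\<beta> n * (C + \<delta> * L) \<le> L" using L by (simp add: field_simps)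
    hence "\<beta> n \<le> L / (C + \<delta> * L)" using C \<delta> L by (simp add: field_simps add_pos_pos)
    hence "\<beta> n * C - L \<le> L / (C + \<delta> * L) * C - L"
      using C by (intro diff_right_mono mult_right_mono) auto
    also have "\<dots> = - (\<delta> * L\<^sup>2 / (C + \<delta> * L))"
    proof -
      have "C + \<delta> * L > 0" using C \<delta> L by (simp add: add_pos_pos)
      thus ?thesis by (simp add: field_simps power2_eq_square)
    qed
    finally have *: "\<beta> n * C - L \<le> - (\<delta> * L\<^sup>2 / (C + \<delta> * L))" .
    \<comment> \<open>The larger of the two summands in the denominator \<open>C + \<delta> L\<close> decides; the first case is
      that of very large \<open>\<omega>\<close>.\<close>
    have "exp (\<beta> n * C - L) \<le> exp (- (\<omega> n / 4)) + exp (- (real n * (ln (real n) - 1) / 2))"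
    proof (cases "\<delta> * L \<ge> C")
      case True
      have "L / 2 = \<delta> * L\<^sup>2 / (2 * (\<delta> * L))" using \<delta> L by (simp add: power2_eq_square)
      also have "\<dots> \<le> \<delta> * L\<^sup>2 / (C + \<delta> * L)"
        using True C \<delta> L by (intro divide_left_mono mult_pos_pos add_pos_pos) (auto simp: mult.commute)
      finally have "\<beta> n * C - L \<le> - (real n * (ln (real n) - 1) / 2)" using * L by simp
      hence "exp (\<beta> n * C - L) \<le> exp (- (real n * (ln (real n) - 1) / 2))" by simp
      thus ?thesis using exp_ge_zero[of "- (\<omega> n / 4)"] by linarith
    next
      case False
      have "\<omega> n / 4 = \<delta> * (real n * (ln (real n) / 2))\<^sup>2 / real n ^ 2"
        using ln2 elim by (simp add: \<delta>_def power2_eq_square)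
      also have "\<dots> \<le> \<delta> * L\<^sup>2 / real n ^ 2"
      proof (intro divide_right_mono mult_left_mono power_mono)
        have "real n * (ln (real n) / 2) \<le> real n * (ln (real n) - 1)"
          using ln2 by (intro mult_left_mono) auto
        thus "real n * (ln (real n) / 2) \<le> L" using L by simp
      qed (use \<delta> ln2 in auto)
      also have "\<dots> \<le> \<delta> * L\<^sup>2 / (C + \<delta> * L)"
        using False C \<delta> L elim by (intro divide_left_mono mult_pos_pos add_pos_pos) auto
      finally have "\<beta> n * C - L \<le> - (\<omega> n / 4)" using * by linarith
      hence "exp (\<beta> n * C - L) \<le> exp (- (\<omega> n / 4))" unfolding exp_le_cancel_iff .
      thus ?thesis using exp_ge_zero[of "- (real n * (ln (real n) - 1) / 2)"] by linarith
    qed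
    thus ?case
      by (simp add: fixed_point_term_def C_def L_def exp_diff)
  qed
  have "((\<lambda>n. exp (- (\<omega> n / 4))) \<longlongrightarrow> 0) sequentially"
    using \<omega> by (intro filterlim_compose[OF exp_at_bot] filterlim_uminus_at_bot_at_top[THEN filterlim_compose]
        filterlim_at_top_mult_tendsto_pos[OF tendsto_const, of "1/4", simplified])
  moreover have "(\<lambda>n. exp (- (real n * (ln (real n) - 1) / 2))) \<longlonglongrightarrow> 0" by real_asymp
  ultimately have lim: "(\<lambda>n. exp (- (\<omega> n / 4)) + exp (- (real n * (ln (real n) - 1) / 2))) \<longlonglongrightarrow> 0"
    using tendsto_add by fastforce
  show ?thesis
    by (rule tendsto_sandwich[OF _ bound tendsto_const lim]) simp
qed

text \<open>Since \<open>\<beta>\<close> lies below the critical value, all terms with \<open>f < n\<close> are replaced by their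
values at the critical one; only the term \<open>f = n\<close> needs the actual \<open>\<beta>\<close>.\<close>
lemma perm_partition_sum_tendsto:
  fixes \<beta> \<omega> :: "nat \<Rightarrow> real"
  assumes \<omega>: "filterlim \<omega> at_top sequentially"
  assumes \<beta>: "eventually (\<lambda>n. 0 \<le> \<beta> n \<and>
      \<beta> n * (real (n choose 2) / ln (fact n) + \<omega> n / (ln (real n))\<^sup>2) \<le> 1) sequentially"
  shows "(\<lambda>n. perm_partition_sum (\<beta> n) n / fact n) \<longlonglongrightarrow> 1"
proof -
  \<comment> \<open>With the cut-off \<open>K\<close> of size \<open>8 ln n\<close>, \<open>U\<close> bounds \<open>exp(\<beta> K^2)\<close> and \<open>V\<close> bounds
      \<open>1/K!\<close>. \<open>W\<close> bounds the sum of the terms with \<open>K < f < n\<close>: the term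
      \<open>f = n - 1\<close> and at most \<open>n\<close> others below the sum of the two end terms.\<close>
  define U where "U x = exp (2 * ln x / (x - 1) * (8 * ln x + 1) ^ 2)" for x :: real
  define V where "V x = 2 / x ^ 4" for x :: real
  define W where "W x = x * exp (- (2 * (ln x - 1))) + x * (U x * V x
      + x ^ 2 * exp (- (2 * (ln x - 1) / (x - 1) * (2 * x - 3))))" for x :: real
  define H where "H n = fixed_point_term (\<beta> n) n + W (real n)" for n
  have "(\<lambda>n. W (real n)) \<longlonglongrightarrow> 0"
    unfolding W_def U_def V_def by real_asymp
  hence H: "H \<longlonglongrightarrow> 0"
    unfolding H_def using tendsto_add[OF fixed_point_term_self_tendsto_0[OF \<omega> \<beta>]] by fastforce
  have U: "(\<lambda>n. U (real n)) \<longlonglongrightarrow> 1" unfolding U_def by real_asymp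
  have nV: "(\<lambda>n. real n * V (real n)) \<longlonglongrightarrow> 0" unfolding V_def by real_asymp
  have small: "eventually (\<lambda>n::nat. 2 * ln (real n) / (real n - 1) \<le> ln 2) sequentially" by real_asymp
  have upper: "eventually (\<lambda>n. perm_partition_sum (\<beta> n) n / fact n
      \<le> U n + H n * exp 1 + (U n * exp 1 + H n) * (real n * V n)) sequentially"
    using \<beta> filterlim_at_top_dense[THEN iffD1, OF \<omega>, rule_format, of 0] eventually_ge_at_top[of "3::nat"] small
  proof eventually_elim
    case (elim n)
    let ?c = "critical_beta n"
    define K where "K = nat \<lceil>8 * ln (real n)\<rceil>"
    have ln_pos: "ln (real n) > 0" using elim by simp
    have K: "real K \<le> 8 * ln (real n) + 1" "8 * ln (real n) \<le> real K" "1 \<le> K"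
      unfolding K_def using ln_pos by linarith+
    have "real n \<le> real (fact n)" unfolding of_nat_le_iff by (rule fact_ge_self)
    hence L: "ln (fact n :: real) > 0" using elim by (intro ln_gt_zero) simp
    have C: "real (n choose 2) > 0" using elim by (simp add: real_choose_two)
    have "\<beta> n * (real (n choose 2) / ln (fact n))
        \<le> \<beta> n * (real (n choose 2) / ln (fact n) + \<omega> n / (ln (real n))\<^sup>2)"
      using elim by (intro mult_left_mono) auto
    also have "\<dots> \<le> 1" using elim by simp
    finally have \<beta>c: "\<beta> n \<le> ?c"
      using L C by (simp add: critical_beta_def pos_le_divide_eq pos_divide_le_eq)
    have c: "?c \<le> 2 * ln (real n) / (real n - 1)" using elim by (intro critical_beta_le) auto
    have c0: "0 \<le> ?c" using \<beta>c elim by linarith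
    have "exp (\<beta> n) \<le> exp (ln 2)" unfolding exp_le_cancel_iff using \<beta>c c elim by linarith
    hence exp2: "exp (\<beta> n) \<le> 2" by simp
    have cK: "exp (?c * real K ^ 2) \<le> U n"
      unfolding U_def exp_le_cancel_iff using c c0 K ln_pos elim
      by (intro mult_mono power_mono) auto
    have "exp (\<beta> n * real K ^ 2) \<le> exp (?c * real K ^ 2)"
      using \<beta>c by (simp add: mult_right_mono)
    with cK have E: "exp (\<beta> n * real K ^ 2) \<le> U n" by linarith
    \<comment> \<open>\<open>K \<ge> 8 ln n\<close> makes \<open>K!\<close> at least \<open>n^4/2\<close>, which outweighs the factor \<open>n\<close> for the
        number of terms.\<close>
    have "real n ^ 4 = exp (real 4 * ln (real n))"
      unfolding exp_of_nat_mult using elim by simp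
    also have "\<dots> \<le> exp (real K / 2)" using K by simp
    also have "\<dots> \<le> 2 * fact K" by (rule exp_half_le_fact)
    finally have V: "1 / fact K \<le> V n"
      using elim by (simp add: V_def field_simps)
    have gK: "fixed_point_term ?c K \<le> U n * V n"
    proof -
      have "K choose 2 \<le> K * (K - 1)" by (simp add: choose_two)
      also have "\<dots> \<le> K ^ 2" by (simp add: power2_eq_square)
      finally have "K choose 2 \<le> K ^ 2" .
      hence "real (K choose 2) \<le> real (K ^ 2)" by (simp only: of_nat_le_iff)
      hence "exp (?c * real (K choose 2)) \<le> exp (?c * real K ^ 2)"
        using c0 by (simp add: mult_left_mono)
      with cK have "exp (?c * real (K choose 2)) \<le> U n" by linarith
      hence "exp (?c * real (K choose 2)) * (1 / fact K) \<le> U n * V n"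
        using V by (intro mult_mono) (auto simp: U_def)
      thus ?thesis by (simp add: fixed_point_term_def)
    qed
    define g where "g = U n * V n
      + real n ^ 2 * exp (- (2 * (ln (real n) - 1) / (real n - 1) * (2 * real n - 3)))"
    have G: "(\<Sum>f\<in>{K<..n}. fixed_point_term (\<beta> n) f) \<le> H n"
    proof -
      have "(\<Sum>f\<in>{K<..n}. fixed_point_term (\<beta> n) f)
          \<le> (\<Sum>f\<in>insert n (insert (n - 1) {K<..n - 2}). fixed_point_term (\<beta> n) f)"
        by (rule sum_mono2) auto
      also have "\<dots> = fixed_point_term (\<beta> n) n + (fixed_point_term (\<beta> n) (n - 1)
          + (\<Sum>f\<in>{K<..n - 2}. fixed_point_term (\<beta> n) f))"
        using elim by (subst sum.insert; (subst sum.insert)?) auto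
      also have "fixed_point_term (\<beta> n) (n - 1) \<le> real n * exp (- (2 * (ln (real n) - 1)))"
        by (rule order.trans[OF fixed_point_term_mono[OF \<beta>c] fixed_point_term_critical_pred])
           (use elim in simp)
      also have "(\<Sum>f\<in>{K<..n - 2}. fixed_point_term (\<beta> n) f) \<le> (\<Sum>f\<in>{K<..n - 2}. g)"
      proof (rule sum_mono)
        fix f assume f: "f \<in> {K<..n - 2}"
        have "fixed_point_term (\<beta> n) f \<le> fixed_point_term ?c f" by (rule fixed_point_term_mono[OF \<beta>c])
        also have "\<dots> \<le> max (fixed_point_term ?c K) (fixed_point_term ?c (n - 2))"
          using f K by (intro fixed_point_term_le_max) auto
        also have "\<dots> \<le> fixed_point_term ?c K + fixed_point_term ?c (n - 2)" by simp
        also have "\<dots> \<le> g"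
          unfolding g_def by (intro add_mono gK fixed_point_term_critical_pred2) (use elim in simp)
        finally show "fixed_point_term (\<beta> n) f \<le> g" .
      qed
      also have "\<dots> \<le> real n * g"
        using elim by (auto simp: g_def U_def V_def intro!: mult_right_mono)
      finally show ?thesis by (simp add: H_def W_def g_def)
    qed
    have G0: "0 \<le> (\<Sum>f\<in>{K<..n}. fixed_point_term (\<beta> n) f)" by (intro sum_nonneg) auto
    have "perm_partition_sum (\<beta> n) n / fact n
       \<le> exp (\<beta> n * real K ^ 2) + (\<Sum>f\<in>{K<..n}. fixed_point_term (\<beta> n) f) * exp 1
         + (exp (\<beta> n * real K ^ 2) * exp 1 + (\<Sum>f\<in>{K<..n}. fixed_point_term (\<beta> n) f)) * (real n / fact K)"
      using perm_partition_sum_le[OF _ exp2 K(3), of n] elim by (simp add: field_simps)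
    also have "\<dots> \<le> U n + H n * exp 1 + (U n * exp 1 + H n) * (real n * V n)"
      using V G0 G E mult_left_mono[OF V, of "real n"]
      by (intro add_mono mult_mono) (auto simp: U_def intro: order.trans)
    finally show ?case .
  qed
  have lower: "eventually (\<lambda>n. 1 \<le> perm_partition_sum (\<beta> n) n / fact n) sequentially"
    using \<beta> by eventually_elim (auto intro: perm_partition_sum_ge)
  have "(\<lambda>n. U n + H n * exp 1 + (U n * exp 1 + H n) * (real n * V n))
      \<longlonglongrightarrow> 1 + 0 * exp 1 + (1 * exp 1 + 0) * 0"
    by (intro tendsto_intros U H nV)
  thus ?thesis
    using tendsto_sandwich[OF lower upper tendsto_const] by simp
qed

section \<open>From tuples to single permutations\<close>

text \<open>Jensen's inequality for \<open>exp\<close>, from the tangent line at the mean.\<close>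
lemma exp_average_le:
  fixes y :: "'a \<Rightarrow> real"
  assumes "finite I" "I \<noteq> {}"
  shows "real (card I) * exp ((\<Sum>k\<in>I. y k) / real (card I)) \<le> (\<Sum>k\<in>I. exp (y k))"
proof -
  define a where "a = (\<Sum>k\<in>I. y k) / real (card I)"
  have "real (card I) > 0" using assms by (simp add: card_gt_0_iff)
  hence "(\<Sum>k\<in>I. y k - a) = 0" by (simp add: sum_subtractf a_def)
  hence "real (card I) * exp a = (\<Sum>k\<in>I. exp a * (1 + (y k - a)))"
    by (simp add: sum.distrib sum_distrib_left[symmetric])
  also have "\<dots> \<le> (\<Sum>k\<in>I. exp a * exp (y k - a))"
    by (intro sum_mono mult_left_mono exp_ge_add_one_self) auto
  also have "\<dots> = (\<Sum>k\<in>I. exp (y k))" by (simp add: exp_add[symmetric])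
  finally show ?thesis by (simp add: a_def)
qed

lemma sum_ordered_pairs_eq_stars:
  fixes s :: "nat \<Rightarrow> nat \<Rightarrow> real"
  assumes sym: "\<And>k l. k \<in> {1..m} \<Longrightarrow> l \<in> {1..m} \<Longrightarrow> s k l = s l k"
  shows "2 * (\<Sum>(k, l)\<in>{(k, l). 1 \<le> k \<and> k < l \<and> l \<le> m}. s k l)
       = (\<Sum>k\<in>{1..m}. \<Sum>l\<in>{1..m} - {k}. s k l)"
proof -
  let ?P = "{(k, l). 1 \<le> k \<and> k < l \<and> l \<le> m}"
  have fin: "finite ?P" by (rule finite_subset[of _ "{1..m} \<times> {1..m}"]) auto
  have "(\<Sum>(k, l)\<in>?P. s k l) = (\<Sum>(k, l)\<in>prod.swap ` ?P. s k l)"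
    by (subst sum.reindex) (auto intro!: sum.cong sym)
  hence "2 * (\<Sum>(k, l)\<in>?P. s k l) = (\<Sum>(k, l)\<in>?P \<union> prod.swap ` ?P. s k l)"
    using fin by (subst sum.union_disjoint) auto
  also have "?P \<union> prod.swap ` ?P = (SIGMA k:{1..m}. {1..m} - {k})"
    by (auto simp: image_iff)
  also have "(\<Sum>(k, l)\<in>\<dots>. s k l) = (\<Sum>k\<in>{1..m}. \<Sum>l\<in>{1..m} - {k}. s k l)"
    by (rule sum.Sigma[symmetric]) auto
  finally show ?thesis .
qed

lemma finite_sym_tuples [simp]: "finite (sym_tuples m n)"
  unfolding sym_tuples_def by (intro finite_PiE finite_permutations) auto

lemma card_sym_tuples: "card (sym_tuples m n) = fact n ^ m"
  unfolding sym_tuples_def by (subst card_PiE) (auto simp: card_permutations[of _ n])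

lemma sum_left_translate:
  assumes "p permutes A"
  shows "(\<Sum>q | q permutes A. h (inv p \<circ> q)) = (\<Sum>q | q permutes A. h q)"
  by (rule sum.reindex_bij_witness[of _ "\<lambda>q. p \<circ> q" "\<lambda>q. inv p \<circ> q"])
     (use permutes_inv_o[OF assms] permutes_inv[OF assms] assms in
      \<open>auto simp: o_assoc intro: permutes_compose\<close>)

text \<open>Once \<open>\<pi>_k\<close> is fixed, the other \<open>m - 1\<close> relative permutations run independently through all
permutations.\<close>
lemma sum_star_eq:
  assumes k: "k \<in> {1..m}"
  shows "(\<Sum>\<pi>\<in>sym_tuples m n. exp (c * (\<Sum>l\<in>{1..m} - {k}. real (perm_weight {1..n} (inv (\<pi> k) \<circ> \<pi> l)))))
       = fact n * perm_partition_sum c n ^ (m - 1)"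
proof -
  let ?P = "{p. p permutes {1..n}}"
  \<comment> \<open>The constraint \<open>\<pi>_k = p\<close> is written as a factor, so that for each \<open>p\<close> the sum over
      tuples is a sum of products over all of \<open>{1..m}\<close> and factorises.\<close>
  define F where "F p l q = (if l = k then of_bool (q = p)
      else exp (c * real (perm_weight {1..n} (inv p \<circ> q))))" for p q :: "nat \<Rightarrow> nat" and l
  have fin: "finite ?P" by (rule finite_permutations) simp
  have ins: "(\<Prod>l\<in>{1..m}. g l) = g k * (\<Prod>l\<in>{1..m} - {k}. g l)" for g :: "nat \<Rightarrow> real"
    using k by (intro prod.remove) auto
  have star: "exp (c * (\<Sum>l\<in>{1..m} - {k}. real (perm_weight {1..n} (inv (\<pi> k) \<circ> \<pi> l))))
      = (\<Sum>p\<in>?P. \<Prod>l\<in>{1..m}. F p l (\<pi> l))" if "\<pi> \<in> sym_tuples m n" for \<pi>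
  proof -
    have pk: "\<pi> k \<in> ?P" using that k unfolding sym_tuples_def by blast
    have "(\<Sum>p\<in>?P. \<Prod>l\<in>{1..m}. F p l (\<pi> l))
        = (\<Sum>p\<in>?P. if \<pi> k = p then \<Prod>l\<in>{1..m} - {k}. F p l (\<pi> l) else 0)"
      by (intro sum.cong refl) (simp only: ins, simp add: F_def)
    also have "\<dots> = (\<Prod>l\<in>{1..m} - {k}. F (\<pi> k) l (\<pi> l))"
      using pk fin by (subst sum.delta') auto
    also have "\<dots> = (\<Prod>l\<in>{1..m} - {k}. exp (c * real (perm_weight {1..n} (inv (\<pi> k) \<circ> \<pi> l))))"
      by (intro prod.cong refl) (auto simp: F_def)
    finally show ?thesis by (simp add: sum_distrib_left exp_sum)
  qed
  have "(\<Sum>\<pi>\<in>sym_tuples m n. exp (c * (\<Sum>l\<in>{1..m} - {k}. real (perm_weight {1..n} (inv (\<pi> k) \<circ> \<pi> l)))))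
      = (\<Sum>\<pi>\<in>sym_tuples m n. \<Sum>p\<in>?P. \<Prod>l\<in>{1..m}. F p l (\<pi> l))"
    by (intro sum.cong refl star)
  also have "\<dots> = (\<Sum>p\<in>?P. \<Sum>\<pi>\<in>sym_tuples m n. \<Prod>l\<in>{1..m}. F p l (\<pi> l))"
    by (rule sum.swap)
  also have "\<dots> = (\<Sum>p\<in>?P. \<Prod>l\<in>{1..m}. \<Sum>q\<in>?P. F p l q)"
    unfolding sym_tuples_def using fin by (intro sum.cong refl prod_sum_PiE[symmetric]) auto
  also have "\<dots> = (\<Sum>p\<in>?P. perm_partition_sum c n ^ (m - 1))"
  proof (intro sum.cong refl)
    fix p assume p: "p \<in> ?P"
    have "(\<Sum>q\<in>?P. F p k q) = 1" using p fin by (simp add: F_def sum.delta)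
    moreover have "(\<Sum>q\<in>?P. F p l q) = perm_partition_sum c n" if "l \<noteq> k" for l
      using sum_left_translate[of p "{1..n}" "\<lambda>q. exp (c * real (perm_weight {1..n} q))"] p that
      by (simp add: F_def perm_partition_sum_def)
    ultimately show "(\<Prod>l\<in>{1..m}. \<Sum>q\<in>?P. F p l q) = perm_partition_sum c n ^ (m - 1)"
      using k by (subst ins) simp
  qed
  also have "\<dots> = fact n * perm_partition_sum c n ^ (m - 1)"
    by (simp add: card_permutations[of _ n])
  finally show ?thesis .
qed

lemma wt_le_stars:
  assumes \<pi>: "\<pi> \<in> sym_tuples m n"
  shows "2 * real (wt m n \<pi>)
    \<le> (\<Sum>k\<in>{1..m}. \<Sum>l\<in>{1..m} - {k}. real (perm_weight {1..n} (inv (\<pi> k) \<circ> \<pi> l)))"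
proof -
  let ?s = "\<lambda>k l. real (perm_weight {1..n} (inv (\<pi> k) \<circ> \<pi> l))"
  have p: "\<pi> k permutes {1..n}" if "k \<in> {1..m}" for k
    using \<pi> that unfolding sym_tuples_def by blast
  have sym: "?s k l = ?s l k" if "k \<in> {1..m}" "l \<in> {1..m}" for k l
  proof -
    note pk = p[OF that(1)] and pl = p[OF that(2)]
    have "inv (inv (\<pi> k) \<circ> \<pi> l) = inv (\<pi> l) \<circ> \<pi> k"
      using pk pl by (simp add: o_inv_distrib permutes_bij bij_imp_bij_inv inv_inv_eq)
    thus ?thesis
      using perm_weight_inv[OF permutes_compose[OF pl permutes_inv[OF pk]]] by simp
  qed
  have "real (wt m n \<pi>) = (\<Sum>(k, l)\<in>{(k, l). 1 \<le> k \<and> k < l \<and> l \<le> m}. real (wt_pair n \<pi> k l))"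
    by (simp add: wt_def case_prod_beta)
  also have "\<dots> \<le> (\<Sum>(k, l)\<in>{(k, l). 1 \<le> k \<and> k < l \<and> l \<le> m}. ?s k l)"
    using wt_pair_le p by (intro sum_mono) auto
  finally show ?thesis
    using sum_ordered_pairs_eq_stars[of m ?s, OF sym] by simp
qed

text \<open>Convexity is applied to the average over the centres \<open>k\<close>. The factor \<open>m/2\<close> in the exponent is
sharp: on tuples with all entries equal every star has \<open>m - 1\<close> of the \<open>m (m - 1)/2\<close> edges,
all of the same weight.\<close>
lemma tuple_sum_le:
  assumes m: "m \<ge> 1" and r: "r > 0"
  shows "(\<Sum>\<pi>\<in>sym_tuples m n. exp (real (wt m n \<pi>) / r))
    \<le> fact n * perm_partition_sum (real m / (2 * r)) n ^ (m - 1)"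
proof -
  let ?c = "real m / (2 * r)"
  let ?Y = "\<lambda>\<pi> k. ?c * (\<Sum>l\<in>{1..m} - {k}. real (perm_weight {1..n} (inv (\<pi> k) \<circ> \<pi> l)))"
  have "real m * exp (real (wt m n \<pi>) / r) \<le> (\<Sum>k\<in>{1..m}. exp (?Y \<pi> k))"
    if \<pi>: "\<pi> \<in> sym_tuples m n" for \<pi>
  proof -
    have "real (wt m n \<pi>) / r = 2 * real (wt m n \<pi>) / (2 * r)" by simp
    also have "\<dots> \<le> (\<Sum>k\<in>{1..m}. \<Sum>l\<in>{1..m} - {k}. real (perm_weight {1..n} (inv (\<pi> k) \<circ> \<pi> l))) / (2 * r)"
      using r by (intro divide_right_mono wt_le_stars[OF \<pi>]) auto
    also have "\<dots> = (\<Sum>k\<in>{1..m}. ?Y \<pi> k) / real (card {1..m})"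
      unfolding sum_distrib_left[symmetric] using m by simp
    finally have "real m * exp (real (wt m n \<pi>) / r)
        \<le> real (card {1..m}) * exp ((\<Sum>k\<in>{1..m}. ?Y \<pi> k) / real (card {1..m}))"
      by (simp add: mult_left_mono)
    also have "\<dots> \<le> (\<Sum>k\<in>{1..m}. exp (?Y \<pi> k))"
      by (rule exp_average_le) (use m in auto)
    finally show ?thesis .
  qed
  hence "(\<Sum>\<pi>\<in>sym_tuples m n. real m * exp (real (wt m n \<pi>) / r))
      \<le> (\<Sum>\<pi>\<in>sym_tuples m n. \<Sum>k\<in>{1..m}. exp (?Y \<pi> k))"
    by (rule sum_mono)
  also have "\<dots> = (\<Sum>k\<in>{1..m}. \<Sum>\<pi>\<in>sym_tuples m n. exp (?Y \<pi> k))" by (rule sum.swap)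
  also have "\<dots> = (\<Sum>k\<in>{1..m}. fact n * perm_partition_sum ?c n ^ (m - 1))"
    by (intro sum.cong refl sum_star_eq)
  also have "\<dots> = real m * (fact n * perm_partition_sum ?c n ^ (m - 1))" by simp
  finally show ?thesis using m by (simp add: sum_distrib_left[symmetric])
qed

lemma tuple_sum_ge:
  assumes "r > 0"
  shows "fact n ^ m \<le> (\<Sum>\<pi>\<in>sym_tuples m n. exp (real (wt m n \<pi>) / r))"
proof -
  have "fact n ^ m = (\<Sum>\<pi>\<in>sym_tuples m n. 1 :: real)"
    by (simp add: card_sym_tuples)
  also have "\<dots> \<le> (\<Sum>\<pi>\<in>sym_tuples m n. exp (real (wt m n \<pi>) / r))"
    using assms by (intro sum_mono) simp
  finally show ?thesis .
qed

theorem proposition3p3: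
  fixes m :: nat and \<omega> \<rho> :: "nat \<Rightarrow> real"
  assumes "m \<ge> 2"
    and "filterlim \<omega> at_top sequentially"
    and "eventually (\<lambda>n. \<rho> n \<ge> R m n + \<omega> n / (ln (real n))\<^sup>2) sequentially"
  shows "\<exists>\<epsilon> :: nat \<Rightarrow> real. \<epsilon> \<in> o(\<lambda>_. 1) \<and>
           (\<forall>n. (\<Sum>\<pi> \<in> sym_tuples m n. exp (real (wt m n \<pi>) / \<rho> n))
                  = fact n ^ m * (1 + \<epsilon> n))"
proof -
  define S where "S n = (\<Sum>\<pi>\<in>sym_tuples m n. exp (real (wt m n \<pi>) / \<rho> n))" for n
  define \<beta> where "\<beta> n = real m / (2 * \<rho> n)" for n
  define \<omega>' where "\<omega>' n = 2 / real m * \<omega> n" for n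
  have m: "real m > 0" using assms(1) by simp
  have \<omega>': "filterlim \<omega>' at_top sequentially"
    unfolding \<omega>'_def using m
    by (intro filterlim_tendsto_pos_mult_at_top[OF tendsto_const _ assms(2)]) simp
  have pos: "eventually (\<lambda>n. \<omega> n > 0) sequentially"
    using assms(2) by (simp add: filterlim_at_top_dense)
  have \<rho>: "eventually (\<lambda>n. \<rho> n > 0) sequentially"
    using assms(3) pos eventually_ge_at_top[of "3::nat"]
  proof eventually_elim
    case (elim n)
    have "R m n \<ge> 0" by (simp add: R_def)
    moreover have "\<omega> n / (ln (real n))\<^sup>2 > 0" using elim by simp
    ultimately show ?case using elim by linarith
  qed
  have "eventually (\<lambda>n. 0 \<le> \<beta> n \<and>
      \<beta> n * (real (n choose 2) / ln (fact n) + \<omega>' n / (ln (real n))\<^sup>2) \<le> 1) sequentially"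
    using assms(3) \<rho>
  proof eventually_elim
    case (elim n)
    have "\<beta> n * (real (n choose 2) / ln (fact n) + \<omega>' n / (ln (real n))\<^sup>2)
        = (R m n + \<omega> n / (ln (real n))\<^sup>2) / \<rho> n"
      using m by (simp add: \<beta>_def \<omega>'_def R_def distrib_left add_divide_distrib mult.commute)
    also have "\<dots> \<le> 1" using elim by simp
    finally show ?case using elim by (simp add: \<beta>_def)
  qed
  from perm_partition_sum_tendsto[OF \<omega>' this]
  have "(\<lambda>n. (perm_partition_sum (\<beta> n) n / fact n) ^ (m - 1)) \<longlonglongrightarrow> 1 ^ (m - 1)"
    by (rule tendsto_power)
  hence lim: "(\<lambda>n. (perm_partition_sum (\<beta> n) n / fact n) ^ (m - 1)) \<longlonglongrightarrow> 1" by simp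
  have lower: "eventually (\<lambda>n. 1 \<le> S n / fact n ^ m) sequentially"
    using \<rho> by eventually_elim (simp add: S_def tuple_sum_ge)
  have upper: "eventually (\<lambda>n. S n / fact n ^ m
      \<le> (perm_partition_sum (\<beta> n) n / fact n) ^ (m - 1)) sequentially"
    using \<rho>
  proof eventually_elim
    case (elim n)
    have "S n / fact n ^ m \<le> fact n * perm_partition_sum (\<beta> n) n ^ (m - 1) / fact n ^ m"
      unfolding S_def \<beta>_def using tuple_sum_le[of m "\<rho> n" n] assms(1) elim
      by (intro divide_right_mono) auto
    also have "\<dots> = (perm_partition_sum (\<beta> n) n / fact n) ^ (m - 1)"
      using assms(1) by (cases m) (auto simp: power_divide)
    finally show ?case .
  qed
  have "(\<lambda>n. S n / fact n ^ m) \<longlonglongrightarrow> 1"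
    by (rule tendsto_sandwich[OF lower upper tendsto_const lim])
  hence "(\<lambda>n. S n / fact n ^ m - 1) \<longlonglongrightarrow> 0"
    using tendsto_diff[OF _ tendsto_const[of 1]] by fastforce
  hence "(\<lambda>n. S n / fact n ^ m - 1) \<in> o(\<lambda>_. 1)"
    by (intro smalloI_tendsto) auto
  moreover have "\<forall>n. S n = fact n ^ m * (1 + (S n / fact n ^ m - 1))" by simp
  ultimately show ?thesis unfolding S_def by blast
qed

end
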